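(* Let $\mathcal{I}$ be a finite index set. Given pointed polyhedra $P^i=\{x\in\mathbb{R}^n \mid A^ix\ge b^i\}$, $i\in\mathcal{I}$, and a 0/1-polytope $\Pi=\{\lambda\in\mathbb{R}^{\mathcal{I}}\mid C\lambda\ge d\}$, that is, $\Pi=\operatorname{conv}V$ for some $V\subseteq\{0,1\}^{\mathcal{I}}$. (i) $(\bar x,\{\bar x^i\}_{i\in\mathcal{I}},\bar\lambda)$ is a vertex of the polyhedron $Q$ defined as the set of vectors $(x,\{x^i\}_{i\in\mathcal{I}},\lambda)$ satisfying $$x-\sum_{i\in\mathcal{I}}x^i=0,\qquad A^ix^i-\lambda_ib^i\ge 0\ \ (i\in\mathcal{I}),\qquad C\lambda\ge d$$ if and only if $\bar\lambda$ is a vertex of $\Pi$, and for each $i\in\mathcal{I}$, $\bar x^i$ is a vertex of $P^i$ if $\bar\lambda_i=1$ and $\bar x^i=0$ otherwise. (ii) For any $w\in\mathbb{R}^n$, consider the linear programs $$(\mathrm{A})\quad \max\{w^Tx\mid (x,\{x^i\}_{i\in\mathcal{I}},\lambda)\in Q\},$$ $$(\mathrm{B}_i)\quad \bar w_i:=\max\{w^Tx\mid x\in P^i\}\quad\text{for } i\in\mathcal{I},$$ $$(\mathrm{C})\quad \max\{\bar w^T\lambda\mid\lambda\in\Pi\}.$$ Then $(\mathrm{A})$ is unbounded if and only if $\bar w_i=\infty$ for some $i\in\mathcal{I}$. Next, let $(\mathrm{A})$ be bounded. Then $(\bar x,\{\bar x^i\}_{i\in\mathcal{I}},\bar\lambda)$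 is an optimal solution of $(\mathrm{A})$ if and only if $\bar\lambda_i^{-1}\bar x^i$ is an optimal solution of $(\mathrm{B}_i)$ for each $i\in\mathcal{I}$ with $\bar\lambda_i>0$ and $\bar\lambda$ is an optimal solution of $(\mathrm{C})$.
   Context: A polyhedron is called pointed if it contains no line. In the vectors $(x,\{x^i\}_{i\in\mathcal{I}},\lambda)$ one has $x,x^i\in\mathbb{R}^n$ and $\lambda\in\mathbb{R}^{\mathcal{I}}$. The equation $\bar w_i=\infty$ means that the linear program $(\mathrm{B}_i)$ is unbounded.
   Formalization: Each P^i is assumed nonempty, and Π nonempty for the unboundedness claim. Both characterizations add x̄ = Σ x̄^i; the optimality one also adds, where λ̄_i = 0, A^i x̄^i ≥ 0 and w^T x̄^i = 0. Without these the claims fail. *)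

theory Defs
  imports "HOL-Analysis.Analysis"
begin

text \<open>
  A system \<open>A x \<ge> b\<close> is given by its number \<open>m\<close> of rows together with the rows
  \<open>A k\<close> and right-hand sides \<open>b k\<close> for \<open>k < m\<close>. In this way the systems of a family
  may have different numbers of rows.
\<close>

definition ineq_polyhedron :: "nat \<Rightarrow> (nat \<Rightarrow> 'a::real_inner) \<Rightarrow> (nat \<Rightarrow> real) \<Rightarrow> 'a set" where
  "ineq_polyhedron m A b = {x. \<forall>k<m. A k \<bullet> x \<ge> b k}"

definition pointed :: "'a::real_vector set \<Rightarrow> bool" where
  "pointed P \<longleftrightarrow> \<not> (\<exists>a v. v \<noteq> 0 \<and> range (\<lambda>t::real. a + t *\<^sub>R v) \<subseteq> P)"

definition zero_one_polytope :: "(real ^ 'i::finite) set \<Rightarrow> bool" where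
  "zero_one_polytope S \<longleftrightarrow> (\<exists>V. V \<subseteq> {v. \<forall>i. v $ i \<in> {0, 1}} \<and> S = convex hull V)"

definition extended_polyhedron ::
  "('i::finite \<Rightarrow> nat) \<Rightarrow> ('i \<Rightarrow> nat \<Rightarrow> real ^ 'n::finite) \<Rightarrow> ('i \<Rightarrow> nat \<Rightarrow> real) \<Rightarrow>
   nat \<Rightarrow> (nat \<Rightarrow> real ^ 'i) \<Rightarrow> (nat \<Rightarrow> real) \<Rightarrow>
   ((real ^ 'n) \<times> (real ^ 'n ^ 'i) \<times> (real ^ 'i)) set" where
  "extended_polyhedron m A b r C d =
     {(x, y, l). x - (\<Sum>i\<in>UNIV. y $ i) = 0 \<and>
                 (\<forall>i. \<forall>k<m i. A i k \<bullet> (y $ i) - l $ i * b i k \<ge> 0) \<and>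
                 (\<forall>k<r. C k \<bullet> l \<ge> d k)}"

definition max_unbounded :: "('a \<Rightarrow> real) \<Rightarrow> 'a set \<Rightarrow> bool" where
  "max_unbounded f S \<longleftrightarrow> \<not> bdd_above (f ` S)"

definition max_value :: "('a \<Rightarrow> real) \<Rightarrow> 'a set \<Rightarrow> ereal" where
  "max_value f S = (SUP x\<in>S. ereal (f x))"

text \<open>
  The objective may take extended real values, because the coefficients of the outer
  linear program are themselves optimal values.
\<close>

definition max_optimal :: "('a \<Rightarrow> 'b::linorder) \<Rightarrow> 'a set \<Rightarrow> 'a \<Rightarrow> bool" where
  "max_optimal f S x \<longleftrightarrow> is_arg_max f (\<lambda>y. y \<in> S) x"

end

theory Submission
  imports Defs
begin

text \<open>
  The system defining \<open>Q\<close> is homogeneous in each pair \<open>(x\<^sup>i, \<lambda>\<^sub>i)\<close>: for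
  \<open>t > 0\<close> the solutions of \<open>A\<^sup>i y \<ge> t b\<^sup>i\<close> are the dilate \<open>t P\<^sup>i\<close>, and for
  \<open>t = 0\<close> they are the recession cone of \<open>P\<^sup>i\<close>. Hence \<open>Q\<close> consists of a point
  \<open>\<lambda>\<close> of \<open>\<Pi>\<close> and, over it, an independent choice of a point from the slice of height
  \<open>\<lambda>\<^sub>i\<close> for every \<open>i\<close>. The arguments combine points of different
  slices by adding and scaling them (\<open>slice_add\<close>, \<open>slice_scaleR\<close>).

  Vertices. A point of a convex set is extreme iff it cannot be moved both forwards and backwards
  along some nonzero vector (\<open>extreme_point_of_iff_perturbation\<close>). Let
  \<open>(x, y, \<lambda>)\<close> be a vertex of \<open>Q\<close>. Moving one block alone shows that
  \<open>y\<^sub>i = 0\<close> where \<open>\<lambda>\<^sub>i = 0\<close>, since a slice of height 0 is a cone, and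
  that \<open>y\<^sub>i\<close> is a vertex of \<open>P\<^sup>i\<close> where \<open>\<lambda>\<^sub>i = 1\<close>. A move
  \<open>\<delta>\<close> of \<open>\<lambda>\<close> inside \<open>\<Pi>\<close> lifts to \<open>Q\<close> by rescaling every block in
  proportion to \<open>\<lambda>\<^sub>i\<close>, so \<open>\<lambda>\<close> is a vertex of \<open>\<Pi>\<close>, hence a 0/1 vector.
  Conversely, a two-sided move of a point of the described form fixes \<open>\<lambda>\<close> and the blocks with
  \<open>\<lambda>\<^sub>i = 1\<close>, and in a block with \<open>\<lambda>\<^sub>i = 0\<close> it would be a line direction
  of the pointed \<open>P\<^sup>i\<close>.

  Unboundedness. Some \<open>\<lambda>\<^sub>i\<close> may vanish throughout \<open>\<Pi>\<close>, so points of
  \<open>P\<^sup>i\<close> of large value may not be available in \<open>Q\<close>; rays always are, because they can be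
  added to a slice of any height. So the key fact is that a linear objective unbounded on a polyhedron
  increases along a ray of it (\<open>unbounded_ineq_polyhedron_has_increasing_ray\<close>), a form of
  Farkas' lemma.

  Optimality. If \<open>w \<bullet> x\<close> has the finite supremum \<open>h\<^sub>i\<close> over
  \<open>P\<^sup>i\<close>, then \<open>w \<bullet> y \<le> t h\<^sub>i\<close> on the slice of height \<open>t\<close>
  (\<open>inner_slice_le\<close>), so the objective of (A) is at most \<open>\<Sum>i. h\<^sub>i \<lambda>\<^sub>i\<close>,
  and points over a fixed \<open>\<lambda>\<close> come arbitrarily close to this bound. Optimality in (A)
  therefore means that the bound is tight in every block and that \<open>\<lambda>\<close> maximises it
  (\<open>max_optimal_extended_polyhedron\<close>). Tightness in block \<open>i\<close> means that
  \<open>y\<^sub>i / \<lambda>\<^sub>i\<close> is optimal over \<open>P\<^sup>i\<close>, or, at height 0, that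
  \<open>y\<^sub>i\<close> is a ray of value 0 (\<open>inner_slice_eq_iff\<close>).
\<close>

section \<open>The homogenised system\<close>

text \<open>
  The section at height \<open>t\<close> of the homogenisation cone
  \<open>{(y, t). A y \<ge> t b}\<close>; at height 0 it is the recession cone of the polyhedron.
\<close>

definition slice :: "nat \<Rightarrow> (nat \<Rightarrow> 'a::real_inner) \<Rightarrow> (nat \<Rightarrow> real) \<Rightarrow> real \<Rightarrow> 'a set" where
  "slice m A b t = ineq_polyhedron m A (\<lambda>k. t * b k)"

lemma mem_slice: "y \<in> slice m A b t \<longleftrightarrow> (\<forall>k<m. t * b k \<le> A k \<bullet> y)"
  by (simp add: slice_def ineq_polyhedron_def)

lemma slice_1: "slice m A b 1 = ineq_polyhedron m A b"
  by (simp add: slice_def)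

lemma mem_slice_0: "y \<in> slice m A b 0 \<longleftrightarrow> (\<forall>k<m. 0 \<le> A k \<bullet> y)"
  by (simp add: mem_slice)

lemma slice_add:
  "y \<in> slice m A b s \<Longrightarrow> z \<in> slice m A b t \<Longrightarrow> y + z \<in> slice m A b (s + t)"
  by (auto simp: mem_slice inner_add_right distrib_right intro: add_mono)

lemma slice_scaleR:
  "0 \<le> c \<Longrightarrow> y \<in> slice m A b t \<Longrightarrow> c *\<^sub>R y \<in> slice m A b (c * t)"
  by (auto simp: mem_slice mult.assoc intro: mult_left_mono)

lemma slice_pos_iff:
  assumes "0 < t"
  shows "y \<in> slice m A b t \<longleftrightarrow> inverse t *\<^sub>R y \<in> ineq_polyhedron m A b"
proof
  assume "y \<in> slice m A b t"
  from slice_scaleR[OF _ this, of "inverse t"] assms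
  show "inverse t *\<^sub>R y \<in> ineq_polyhedron m A b"
    by (simp add: slice_1)
next
  assume "inverse t *\<^sub>R y \<in> ineq_polyhedron m A b"
  then have "inverse t *\<^sub>R y \<in> slice m A b 1"
    by (simp add: slice_1)
  from slice_scaleR[OF _ this, of t] assms show "y \<in> slice m A b t"
    by simp
qed

lemma ineq_polyhedron_add_ray:
  assumes "x \<in> ineq_polyhedron m A b" "v \<in> slice m A b 0" "0 \<le> s"
  shows "x + s *\<^sub>R v \<in> ineq_polyhedron m A b"
  using slice_add[of x m A b 1 "s *\<^sub>R v" 0] slice_scaleR[OF assms(3,2)] assms(1)
  by (simp add: slice_1)

text \<open>
  A vector that is a ray in both directions spans a line through any point of the polyhedron.
\<close>
lemma pointed_no_opposite_rays:
  assumes "pointed (ineq_polyhedron m A b)" "ineq_polyhedron m A b \<noteq> {}"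
    and v: "v \<in> slice m A b 0" "- v \<in> slice m A b 0"
  shows "v = 0"
proof (rule ccontr)
  assume "v \<noteq> 0"
  obtain a where a: "a \<in> ineq_polyhedron m A b"
    using assms(2) by blast
  have "a + t *\<^sub>R v \<in> ineq_polyhedron m A b" for t
  proof (cases "0 \<le> t")
    case True
    then show ?thesis
      by (rule ineq_polyhedron_add_ray[OF a v(1)])
  next
    case False
    then show ?thesis
      using ineq_polyhedron_add_ray[OF a v(2), of "- t"] by simp
  qed
  then show False
    using assms(1) \<open>v \<noteq> 0\<close> by (auto simp: pointed_def)
qed

lemma convex_ineq_polyhedron: "convex (ineq_polyhedron m A b)"
proof -
  have "ineq_polyhedron m A b = (\<Inter>k\<in>{..<m}. {x. b k \<le> A k \<bullet> x})"
    by (auto simp: ineq_polyhedron_def)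
  then show ?thesis
    by (simp add: convex_INT convex_halfspace_ge)
qed

lemma mem_extended_polyhedron:
  "(x, y, l) \<in> extended_polyhedron m A b r C d \<longleftrightarrow>
     x = (\<Sum>i\<in>UNIV. y $ i) \<and> (\<forall>i. y $ i \<in> slice (m i) (A i) (b i) (l $ i)) \<and>
     l \<in> ineq_polyhedron r C d"
  by (auto simp: extended_polyhedron_def mem_slice ineq_polyhedron_def)

lemma convex_extended_polyhedron: "convex (extended_polyhedron m A b r C d)"
  unfolding convex_def
  using convex_ineq_polyhedron[of r C d, unfolded convex_def]
  by (auto simp: mem_extended_polyhedron sum.distrib scaleR_sum_right intro!: slice_add slice_scaleR)

section \<open>Vertices\<close>

text \<open>
  A point in the open segment from \<open>a\<close> to \<open>c\<close> can be moved a little along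
  \<open>c - a\<close> in both directions. The perturbation form avoids carrying two endpoints and a
  parameter through the vertex arguments.
\<close>
lemma extreme_point_of_iff_perturbation:
  fixes x :: "'a::real_vector"
  assumes "convex S"
  shows "x extreme_point_of S \<longleftrightarrow> x \<in> S \<and> (\<forall>v. x + v \<in> S \<longrightarrow> x - v \<in> S \<longrightarrow> v = 0)"
    (is "_ \<longleftrightarrow> _ \<and> ?rigid")
proof (cases "x \<in> S")
  case True
  have "?rigid" if ext: "x extreme_point_of S"
  proof (intro allI impI)
    fix v assume v: "x + v \<in> S" "x - v \<in> S"
    show "v = 0"
    proof (rule ccontr)
      assume "v \<noteq> 0"
      then have "x - v \<noteq> x + v"
        by (metis add_diff_cancel_left' diff_add_cancel diff_minus_eq_add eq_neg_iff_add_eq_0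
            scaleR_2 scaleR_eq_0_iff zero_neq_numeral)
      moreover have "x = (1 - 1/2) *\<^sub>R (x - v) + (1/2) *\<^sub>R (x + v)"
        by (simp add: algebra_simps flip: scaleR_add_left)
      ultimately have "x \<in> open_segment (x - v) (x + v)"
        unfolding in_segment by (intro conjI exI[of _ "1/2"]) auto
      then show False
        using ext v by (auto simp: extreme_point_of_def)
    qed
  qed
  moreover have "x \<notin> open_segment a c" if rigid: ?rigid and ac: "a \<in> S" "c \<in> S" for a c
  proof
    assume "x \<in> open_segment a c"
    then obtain u where u: "0 < u" "u < 1" "x = (1 - u) *\<^sub>R a + u *\<^sub>R c" and "a \<noteq> c"
      by (auto simp: in_segment)
    define s where "s = min u (1 - u)"
    have on_segment: "(1 - t) *\<^sub>R a + t *\<^sub>R c \<in> S" if "0 \<le> t" "t \<le> 1" for t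
      using that ac assms by (simp add: convexD_alt)
    have "x + s *\<^sub>R (c - a) = (1 - (u + s)) *\<^sub>R a + (u + s) *\<^sub>R c"
      and "x - s *\<^sub>R (c - a) = (1 - (u - s)) *\<^sub>R a + (u - s) *\<^sub>R c"
      by (simp_all add: u(3) algebra_simps)
    moreover have "0 \<le> u + s" "u + s \<le> 1" "0 \<le> u - s" "u - s \<le> 1" "s \<noteq> 0"
      using u(1,2) by (auto simp: s_def)
    ultimately have "s *\<^sub>R (c - a) = 0"
      using rigid on_segment by metis
    then show False
      using \<open>s \<noteq> 0\<close> \<open>a \<noteq> c\<close> by simp
  qed
  ultimately show ?thesis
    using True by (auto simp: extreme_point_of_def)
qed (simp add: extreme_point_of_def)

text \<open>
  The slab \<open>0 \<le> l\<^sub>i \<le> 1\<close> is convex and contains the generators.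
\<close>
lemma zero_one_polytope_bounds:
  assumes "zero_one_polytope S" "l \<in> S"
  shows "0 \<le> l $ i" "l $ i \<le> 1"
proof -
  obtain V where V: "V \<subseteq> {v. \<forall>i. v $ i \<in> {0, 1}}" "S = convex hull V"
    using assms(1) by (auto simp: zero_one_polytope_def)
  have "convex hull V \<subseteq> {l. axis i 1 \<bullet> l \<ge> 0} \<inter> {l. axis i 1 \<bullet> l \<le> 1}"
  proof (rule hull_minimal)
    show "V \<subseteq> {l. axis i 1 \<bullet> l \<ge> 0} \<inter> {l. axis i 1 \<bullet> l \<le> 1}"
    proof
      fix v assume "v \<in> V"
      then have "v $ i \<in> {0, 1}"
        using V(1) by blast
      then show "v \<in> {l. axis i 1 \<bullet> l \<ge> 0} \<inter> {l. axis i 1 \<bullet> l \<le> 1}"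
        by (auto simp: inner_axis')
    qed
  qed (intro convex_Int convex_halfspace_ge convex_halfspace_le)
  then show "0 \<le> l $ i" "l $ i \<le> 1"
    using assms(2) V(2) by (auto simp: inner_axis')
qed

lemma zero_one_polytope_vertex:
  assumes "zero_one_polytope S" "l extreme_point_of S"
  shows "l $ i = 0 \<or> l $ i = 1"
  using assms extreme_point_of_convex_hull unfolding zero_one_polytope_def by blast

text \<open>
  The coordinate \<open>x\<close> is determined by \<open>y\<close>, so only perturbations
  \<open>(\<eta>, \<delta>)\<close> of \<open>(y, l)\<close> matter. From right to left, pointedness
  excludes perturbations of the blocks with \<open>l\<^sub>i = 0\<close>.
\<close>
lemma extreme_point_of_extended_polyhedron:
  fixes A :: "'i::finite \<Rightarrow> nat \<Rightarrow> real ^ 'n::finite" and C :: "nat \<Rightarrow> real ^ 'i"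
    and y :: "real ^ 'n ^ 'i" and l :: "real ^ 'i"
    and m :: "'i \<Rightarrow> nat" and b :: "'i \<Rightarrow> nat \<Rightarrow> real" and r :: nat and d :: "nat \<Rightarrow> real"
  defines "P \<equiv> \<lambda>i. ineq_polyhedron (m i) (A i) (b i)"
    and "S \<equiv> ineq_polyhedron r C d"
    and "Q \<equiv> extended_polyhedron m A b r C d"
  assumes nonempty: "\<And>i. P i \<noteq> {}" and pointed: "\<And>i. pointed (P i)"
    and S_01: "zero_one_polytope S"
  shows "(x, y, l) extreme_point_of Q \<longleftrightarrow>
      x = (\<Sum>i\<in>UNIV. y $ i) \<and> l extreme_point_of S \<and>
      (\<forall>i. if l $ i = 1 then (y $ i) extreme_point_of (P i) else y $ i = 0)"
    (is "?L \<longleftrightarrow> ?R")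
proof
  have convex: "convex Q" "convex S" "convex (P i)" for i
    by (simp_all add: Q_def S_def P_def convex_extended_polyhedron convex_ineq_polyhedron)
  note extreme_iff = convex[THEN extreme_point_of_iff_perturbation]
  have slice_P: "slice (m i) (A i) (b i) 1 = P i" for i
    by (simp add: P_def slice_1)
  note mem_Q = mem_extended_polyhedron[of _ _ _ m A b r C d, folded Q_def S_def]
  {
    assume ?L
    then have "(x, y, l) \<in> Q"
      by (simp add: extreme_point_of_def)
    then have x: "x = (\<Sum>i\<in>UNIV. y $ i)" and l: "l \<in> S"
      and y: "y $ i \<in> slice (m i) (A i) (b i) (l $ i)" for i
      by (simp_all add: mem_Q)
    have rigid: "\<eta> = 0 \<and> \<delta> = 0"
      if "l + \<delta> \<in> S" "l - \<delta> \<in> S"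
        and "\<And>i. y $ i + \<eta> $ i \<in> slice (m i) (A i) (b i) (l $ i + \<delta> $ i)"
        and "\<And>i. y $ i - \<eta> $ i \<in> slice (m i) (A i) (b i) (l $ i - \<delta> $ i)"
      for \<eta> :: "real ^ 'n ^ 'i" and \<delta>
    proof -
      let ?v = "(\<Sum>i\<in>UNIV. \<eta> $ i, \<eta>, \<delta>)"
      have "(x, y, l) + ?v \<in> Q" "(x, y, l) - ?v \<in> Q"
        using that by (simp_all add: mem_Q x sum.distrib sum_subtractf)
      then have "?v = 0"
        using \<open>?L\<close> unfolding extreme_iff by blast
      then show ?thesis
        by (simp add: prod_eq_iff)
    qed
    have rigid_block: "v = 0"
      if "y $ i + v \<in> slice (m i) (A i) (b i) (l $ i)"
        and "y $ i - v \<in> slice (m i) (A i) (b i) (l $ i)" for i v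
    proof -
      have "axis i v = 0 \<and> (0 :: real ^ 'i) = 0"
        by (rule rigid) (use that l y in \<open>auto simp: axis_def\<close>)
      then show ?thesis
        by (metis axis_nth zero_index)
    qed
    \<comment> \<open>Adding or subtracting \<open>y\<^sub>i\<close> gives \<open>2 y\<^sub>i\<close> or \<open>0\<close>, both in the cone.\<close>
    have y_0: "y $ i = 0" if "l $ i = 0" for i
      using slice_scaleR[OF _ y[of i], of 2] that
      by (intro rigid_block) (auto simp: mem_slice scaleR_2)
    have y_1: "y $ i extreme_point_of P i" if "l $ i = 1" for i
      using y[of i] rigid_block[of i] that by (auto simp: extreme_iff slice_P)
    have ext_l: "l extreme_point_of S"
      unfolding extreme_iff
    proof (intro conjI l allI impI)
      fix \<delta> assume \<delta>: "l + \<delta> \<in> S" "l - \<delta> \<in> S"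
      \<comment> \<open>Block \<open>i\<close> is scaled by \<open>1 \<plusminus> \<delta>\<^sub>i / l\<^sub>i\<close>. Where
        \<open>l\<^sub>i = 0\<close>, nonnegativity on both sides forces \<open>\<delta>\<^sub>i = 0\<close>, and division by zero
        gives the factor 1, as required.\<close>
      let ?q = "\<lambda>i. \<delta> $ i / l $ i"
      have bounds: "0 \<le> l $ i" "0 \<le> l $ i + \<delta> $ i" "0 \<le> l $ i - \<delta> $ i" for i
        using zero_one_polytope_bounds(1)[OF S_01 l]
          zero_one_polytope_bounds(1)[OF S_01 \<delta>(1), of i]
          zero_one_polytope_bounds(1)[OF S_01 \<delta>(2), of i] by simp_all
      have ratio: "?q i * l $ i = \<delta> $ i" "0 \<le> 1 + ?q i" "0 \<le> 1 - ?q i" for i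
        using bounds[of i] by (cases "l $ i = 0"; simp add: field_simps)+
      have "(\<chi> i. ?q i *\<^sub>R y $ i) = 0 \<and> \<delta> = 0"
      proof (rule rigid[OF \<delta>])
        fix i
        show "y $ i + (\<chi> i. ?q i *\<^sub>R y $ i) $ i \<in> slice (m i) (A i) (b i) (l $ i + \<delta> $ i)"
          using slice_scaleR[OF ratio(2)[of i] y[of i]] ratio(1)[of i]
          by (simp add: algebra_simps del: times_divide_eq_left)
        show "y $ i - (\<chi> i. ?q i *\<^sub>R y $ i) $ i \<in> slice (m i) (A i) (b i) (l $ i - \<delta> $ i)"
          using slice_scaleR[OF ratio(3)[of i] y[of i]] ratio(1)[of i]
          by (simp add: algebra_simps del: times_divide_eq_left)
      qed
      then show "\<delta> = 0" ..
    qed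
    show ?R
      using x ext_l y_0 y_1 zero_one_polytope_vertex[OF S_01 ext_l] by metis
  next
    assume R: ?R
    then have x: "x = (\<Sum>i\<in>UNIV. y $ i)" and ext_l: "l extreme_point_of S"
      and y_1: "\<And>i. l $ i = 1 \<Longrightarrow> y $ i extreme_point_of P i"
      and y_0: "\<And>i. l $ i = 0 \<Longrightarrow> y $ i = 0"
      by (auto split: if_splits)
    have l: "l $ i = 0 \<or> l $ i = 1" for i
      by (rule zero_one_polytope_vertex[OF S_01 ext_l])
    have y: "y $ i \<in> slice (m i) (A i) (b i) (l $ i)" for i
      using l[of i]
    proof
      assume "l $ i = 0"
      then show ?thesis
        using y_0[of i] by (simp add: mem_slice_0)
    next
      assume "l $ i = 1"
      then show ?thesis
        using y_1[of i] by (simp add: slice_P extreme_point_of_def)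
    qed
    show ?L
      unfolding extreme_iff
    proof (intro conjI allI impI)
      show "(x, y, l) \<in> Q"
        using x y ext_l by (simp add: mem_Q extreme_point_of_def)
    next
      fix v assume v: "(x, y, l) + v \<in> Q" "(x, y, l) - v \<in> Q"
      obtain \<xi> \<eta> \<delta> where v_eq: "v = (\<xi>, \<eta>, \<delta>)"
        by (cases v)
      have \<delta>: "\<delta> = 0"
        using v ext_l by (simp add: v_eq mem_Q extreme_iff)
      have "\<eta> $ i = 0" for i
      proof (cases "l $ i = 1")
        case True
        then show ?thesis
          using v y_1[OF True] by (simp add: v_eq \<delta> mem_Q extreme_iff slice_P) (metis slice_P)
      next
        case False
        then have "l $ i = 0"
          using l[of i] by simp
        then have "\<eta> $ i \<in> slice (m i) (A i) (b i) 0" "- \<eta> $ i \<in> slice (m i) (A i) (b i) 0"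
          using v y_0[of i] by (simp_all add: v_eq \<delta> mem_Q) (metis add_0 diff_0)+
        then show ?thesis
          using pointed_no_opposite_rays pointed nonempty unfolding P_def by blast
      qed
      then have \<eta>: "\<eta> = 0"
        by (simp add: vec_eq_iff)
      show "v = 0"
        using v(1) x by (simp add: v_eq \<delta> \<eta> mem_Q zero_prod_def)
    qed
  }
qed

section \<open>Unboundedness\<close>

text \<open>
  The vectors \<open>v\<close> for which \<open>v \<bullet> x\<close> is bounded below on the polyhedron form a convex
  cone containing all rows of \<open>A\<close>. An objective \<open>w\<close> unbounded above therefore has
  \<open>-w\<close> outside the cone generated by the rows. As a finitely generated cone is closed, a
  hyperplane separates \<open>-w\<close> from it, and the normal of this hyperplane is the ray.
\<close>
lemma unbounded_ineq_polyhedron_has_increasing_ray: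
  fixes A :: "nat \<Rightarrow> 'a::euclidean_space"
  assumes "\<not> bdd_above ((\<lambda>x. w \<bullet> x) ` ineq_polyhedron m A b)"
  obtains v where "v \<in> slice m A b 0" "0 < w \<bullet> v"
proof -
  let ?P = "ineq_polyhedron m A b"
  let ?K = "convex_cone hull (A ` {..<m})"
  let ?T = "{v. bdd_below ((\<lambda>x. v \<bullet> x) ` ?P)}"
  have "?K \<subseteq> ?T"
  proof (rule hull_minimal)
    show "A ` {..<m} \<subseteq> ?T"
      by (auto simp: ineq_polyhedron_def bdd_below_def)
    show "convex_cone ?T"
      unfolding convex_cone_iff
    proof (intro conjI ballI allI impI)
      fix u v assume "u \<in> ?T" "v \<in> ?T"
      then obtain \<alpha> \<beta> where "\<And>x. x \<in> ?P \<Longrightarrow> \<alpha> \<le> u \<bullet> x" "\<And>x. x \<in> ?P \<Longrightarrow> \<beta> \<le> v \<bullet> x"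
        by (auto simp: bdd_below_def)
      then have "\<And>x. x \<in> ?P \<Longrightarrow> \<alpha> + \<beta> \<le> (u + v) \<bullet> x"
        by (simp add: inner_add_left add_mono)
      then show "u + v \<in> ?T"
        by (auto simp: bdd_below_def)
    next
      fix u and c :: real assume "u \<in> ?T" "0 \<le> c"
      then obtain \<alpha> where "\<And>x. x \<in> ?P \<Longrightarrow> \<alpha> \<le> u \<bullet> x"
        by (auto simp: bdd_below_def)
      then have "\<And>x. x \<in> ?P \<Longrightarrow> c * \<alpha> \<le> (c *\<^sub>R u) \<bullet> x"
        using \<open>0 \<le> c\<close> by (simp add: mult_left_mono)
      then show "c *\<^sub>R u \<in> ?T"
        by (auto simp: bdd_below_def)
    qed (auto simp: bdd_below_def)
  qed
  moreover have "- w \<notin> ?T"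
  proof
    assume "- w \<in> ?T"
    then obtain \<beta> where "\<And>x. x \<in> ?P \<Longrightarrow> \<beta> \<le> (- w) \<bullet> x"
      by (auto simp: bdd_below_def)
    then have "\<And>x. x \<in> ?P \<Longrightarrow> w \<bullet> x \<le> - \<beta>"
      by force
    then show False
      using assms by (auto simp: bdd_above_def)
  qed
  ultimately have "- w \<notin> ?K"
    by (rule contra_subsetD)
  then obtain v \<beta> where v: "v \<bullet> (- w) < \<beta>" "\<And>a. a \<in> ?K \<Longrightarrow> \<beta> < v \<bullet> a"
    using separating_hyperplane_closed_point[of ?K "- w"]
    by (auto simp: convex_convex_cone_hull closed_convex_cone_hull)
  have "\<beta> < 0"
    using v(2)[OF convex_cone_hull_contains_0] by simp
  \<comment> \<open>A multiple of \<open>a\<close> would reach the separating level \<open>\<beta> < 0\<close> if the value at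
    \<open>a\<close> were negative.\<close>
  have "0 \<le> v \<bullet> a" if "a \<in> ?K" for a
  proof (rule ccontr)
    assume "\<not> 0 \<le> v \<bullet> a"
    then have "0 \<le> \<beta> / (v \<bullet> a)"
      using \<open>\<beta> < 0\<close> by (simp add: divide_nonpos_neg)
    then have "\<beta> < v \<bullet> ((\<beta> / (v \<bullet> a)) *\<^sub>R a)"
      using that by (intro v(2) convex_cone_hull_mul)
    then show False
      using \<open>\<not> 0 \<le> v \<bullet> a\<close> by simp
  qed
  then have "v \<in> slice m A b 0"
    by (simp add: mem_slice_0 inner_commute[of _ v] hull_inc)
  moreover have "0 < w \<bullet> v"
    using v(1) \<open>\<beta> < 0\<close> by (simp add: inner_commute)
  ultimately show thesis
    by (rule that)
qed

text \<open>
  The supremum is described by an upper bound and approximating points, which is the form in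
  which the optimality argument passes from the blocks to their sum.
\<close>
lemma max_value_finite:
  assumes "X \<noteq> {}" "max_value f X \<noteq> \<infinity>"
  obtains h where "max_value f X = ereal h" "\<And>x. x \<in> X \<Longrightarrow> f x \<le> h"
    "\<And>e. 0 < e \<Longrightarrow> \<exists>x\<in>X. h - e < f x"
proof -
  have le: "ereal (f x) \<le> max_value f X" if "x \<in> X" for x
    using that unfolding max_value_def by (rule SUP_upper)
  obtain a where "a \<in> X"
    using assms(1) by blast
  from le[OF this] assms(2) obtain h where h: "max_value f X = ereal h"
    by (cases "max_value f X") auto
  show thesis
  proof (rule that[OF h])
    show "f x \<le> h" if "x \<in> X" for x
      using le[OF that] by (simp add: h)
    show "\<exists>x\<in>X. h - e < f x" if "0 < e" for e
    proof -
      have "ereal (h - e) < (SUP x\<in>X. ereal (f x))"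
        using h that by (simp add: max_value_def)
      then show ?thesis
        by (simp add: less_SUP_iff)
    qed
  qed
qed

lemma max_value_eq_infinity_iff:
  assumes "X \<noteq> {}"
  shows "max_value f X = \<infinity> \<longleftrightarrow> \<not> bdd_above (f ` X)"
proof
  show "\<not> bdd_above (f ` X)" if inf: "max_value f X = \<infinity>"
  proof
    assume "bdd_above (f ` X)"
    then obtain h where "\<And>x. x \<in> X \<Longrightarrow> f x \<le> h"
      by (auto simp: bdd_above_def)
    then have "max_value f X \<le> ereal h"
      by (auto simp: max_value_def intro: SUP_least)
    then show False
      by (simp add: inf)
  qed
  show "max_value f X = \<infinity>" if "\<not> bdd_above (f ` X)"
    using that assms max_value_finite[of X f] by (metis bdd_aboveI2)
qed

text \<open>
  For \<open>t > 0\<close> this rescales the bound on the polyhedron. For \<open>t = 0\<close> a ray of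
  positive value would make the objective exceed every bound.
\<close>
lemma inner_slice_le:
  assumes P: "ineq_polyhedron m A b \<noteq> {}"
    and h: "\<And>x. x \<in> ineq_polyhedron m A b \<Longrightarrow> w \<bullet> x \<le> h"
    and t: "0 \<le> t" and y: "y \<in> slice m A b t"
  shows "w \<bullet> y \<le> t * h"
proof (cases "t = 0")
  case False
  then have "w \<bullet> (inverse t *\<^sub>R y) \<le> h"
    using t y by (intro h) (simp add: slice_pos_iff)
  then show ?thesis
    using t False by (simp add: field_simps)
next
  case True
  obtain x where x: "x \<in> ineq_polyhedron m A b"
    using P by blast
  have "w \<bullet> y \<le> 0"
  proof (rule ccontr)
    assume "\<not> w \<bullet> y \<le> 0"
    then have pos: "0 < w \<bullet> y"
      by simp
    \<comment> \<open>Going this far along the ray reaches the value \<open>h + 1\<close>.\<close>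
    let ?s = "(h - w \<bullet> x + 1) / (w \<bullet> y)"
    have "w \<bullet> (x + ?s *\<^sub>R y) \<le> h"
      using ineq_polyhedron_add_ray[OF x, of y ?s] y h[OF x] pos
      by (intro h) (simp add: True)
    then show False
      using pos by (simp add: inner_add_right)
  qed
  then show ?thesis
    by (simp add: True)
qed

text \<open>
  A ray of \<open>P\<^sup>j\<close> that increases the objective can be added to block \<open>j\<close> of any point
  of \<open>Q\<close>. In the other direction, \<open>0 \<le> l\<^sub>i \<le> 1\<close> turns the bounds of the blocks
  into a bound independent of \<open>l\<close>.
\<close>
lemma extended_objective_unbounded_iff:
  fixes A :: "'i::finite \<Rightarrow> nat \<Rightarrow> real ^ 'n::finite" and C :: "nat \<Rightarrow> real ^ 'i"
    and m :: "'i \<Rightarrow> nat" and b :: "'i \<Rightarrow> nat \<Rightarrow> real" and r :: nat and d :: "nat \<Rightarrow> real"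
  defines "P \<equiv> \<lambda>i. ineq_polyhedron (m i) (A i) (b i)"
    and "S \<equiv> ineq_polyhedron r C d"
    and "Q \<equiv> extended_polyhedron m A b r C d"
  assumes nonempty: "\<And>i. P i \<noteq> {}" "S \<noteq> {}" and S_01: "zero_one_polytope S"
  shows "max_unbounded (\<lambda>(x, y, l). w \<bullet> x) Q \<longleftrightarrow>
      (\<exists>i. max_value (\<lambda>x. w \<bullet> x) (P i) = \<infinity>)" (is "?L \<longleftrightarrow> ?R")
proof
  note mem_Q = mem_extended_polyhedron[of _ _ _ m A b r C d, folded Q_def S_def]
  {
    assume ?R
    then obtain j where "\<not> bdd_above ((\<lambda>x. w \<bullet> x) ` P j)"
      using nonempty(1) by (auto simp: max_value_eq_infinity_iff)
    then obtain v where v: "v \<in> slice (m j) (A j) (b j) 0" "0 < w \<bullet> v"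
      unfolding P_def by (rule unbounded_ineq_polyhedron_has_increasing_ray)
    obtain l where l: "l \<in> S"
      using nonempty(2) by blast
    have "\<forall>i. \<exists>x. x \<in> P i"
      using nonempty(1) by blast
    then obtain p where p: "\<And>i. p i \<in> P i"
      by metis
    define y where "y = (\<chi> i. l $ i *\<^sub>R p i)"
    define x where "x = (\<Sum>i\<in>UNIV. y $ i)"
    have y: "y $ i \<in> slice (m i) (A i) (b i) (l $ i)" for i
      using slice_scaleR[of "l $ i" "p i" "m i" "A i" "b i" 1] p[of i]
        zero_one_polytope_bounds(1)[OF S_01 l]
      by (simp add: y_def slice_1 P_def)
    have ray: "(x + s *\<^sub>R v, y + axis j (s *\<^sub>R v), l) \<in> Q" if "0 \<le> s" for s
    proof -
      have "y $ i + axis j (s *\<^sub>R v) $ i \<in> slice (m i) (A i) (b i) (l $ i)" for i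
        using slice_add[OF y[of j] slice_scaleR[OF that v(1)]] y by (auto simp: axis_def)
      moreover have "(\<Sum>i\<in>UNIV. axis j (s *\<^sub>R v) $ i) = s *\<^sub>R v"
        by (simp add: axis_def)
      ultimately show ?thesis
        using l by (simp add: mem_Q x_def sum.distrib)
    qed
    show ?L
      unfolding max_unbounded_def
    proof
      assume "bdd_above ((\<lambda>(x, y, l). w \<bullet> x) ` Q)"
      then obtain M where M: "\<And>x y l. (x, y, l) \<in> Q \<Longrightarrow> w \<bullet> x \<le> M"
        by (force simp: bdd_above_def)
      have "w \<bullet> x \<le> M"
        using M[OF ray[of 0]] by simp
      \<comment> \<open>This step length raises the value at \<open>x\<close> to \<open>M + 1\<close>.\<close>
      then have "0 \<le> (M - w \<bullet> x + 1) / (w \<bullet> v)"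
        using v(2) by simp
      from M[OF ray[OF this]] v(2) show False
        by (simp add: inner_add_right)
    qed
  next
    assume ?L
    show ?R
    proof (rule ccontr)
      assume "\<not> ?R"
      then have "\<forall>i. \<exists>h. \<forall>x\<in>P i. w \<bullet> x \<le> h"
        using nonempty(1) by (auto simp: max_value_eq_infinity_iff bdd_above_def)
      then obtain h where h: "\<And>i x. x \<in> P i \<Longrightarrow> w \<bullet> x \<le> h i"
        by metis
      have "w \<bullet> x \<le> (\<Sum>i\<in>UNIV. \<bar>h i\<bar>)" if "(x, y, l) \<in> Q" for x y l
      proof -
        have l: "l \<in> S" and x: "x = (\<Sum>i\<in>UNIV. y $ i)"
          and y: "\<And>i. y $ i \<in> slice (m i) (A i) (b i) (l $ i)"
          using that by (simp_all add: mem_Q)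
        have "w \<bullet> y $ i \<le> \<bar>h i\<bar>" for i
        proof -
          have "w \<bullet> y $ i \<le> l $ i * h i"
            using nonempty(1)[of i] h[of _ i] y zero_one_polytope_bounds[OF S_01 l]
            unfolding P_def by (intro inner_slice_le)
          also have "\<dots> \<le> l $ i * \<bar>h i\<bar>"
            using zero_one_polytope_bounds[OF S_01 l] by (intro mult_left_mono) auto
          also have "\<dots> \<le> 1 * \<bar>h i\<bar>"
            using zero_one_polytope_bounds[OF S_01 l] by (intro mult_right_mono) auto
          finally show ?thesis
            by simp
        qed
        then show ?thesis
          by (simp add: x inner_sum_right sum_mono)
      qed
      then have "bdd_above ((\<lambda>(x, y, l). w \<bullet> x) ` Q)"
        by (intro bdd_aboveI2[of _ _ "\<Sum>i\<in>UNIV. \<bar>h i\<bar>"]) auto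
      then show False
        using \<open>?L\<close> by (simp add: max_unbounded_def)
    qed
  }
qed

section \<open>Optimal solutions\<close>

lemma max_optimal_iff: "max_optimal f X x \<longleftrightarrow> x \<in> X \<and> (\<forall>z\<in>X. f z \<le> f x)"
  by (auto simp: max_optimal_def is_arg_max_def not_less)

text \<open>
  Since \<open>h\<close> is the supremum over the polyhedron, its points of value \<open>h\<close> are exactly the
  optimal ones.
\<close>
lemma inner_slice_eq_iff:
  assumes h_value: "max_value (\<lambda>x. w \<bullet> x) (ineq_polyhedron m A b) = ereal h" and t: "0 \<le> t"
  shows "y \<in> slice m A b t \<and> w \<bullet> y = t * h \<longleftrightarrow>
      (0 < t \<longrightarrow> max_optimal (\<lambda>x. w \<bullet> x) (ineq_polyhedron m A b) (inverse t *\<^sub>R y)) \<and>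
      (t = 0 \<longrightarrow> (\<forall>k<m. 0 \<le> A k \<bullet> y) \<and> w \<bullet> y = 0)"
proof (cases "t = 0")
  case True
  then show ?thesis
    by (simp add: mem_slice_0)
next
  case False
  have opt: "max_optimal (\<lambda>x. w \<bullet> x) (ineq_polyhedron m A b) z \<longleftrightarrow>
      z \<in> ineq_polyhedron m A b \<and> w \<bullet> z = h" for z
  proof -
    have le: "w \<bullet> x \<le> h" if "x \<in> ineq_polyhedron m A b" for x
      using SUP_upper[OF that, of "\<lambda>x. ereal (w \<bullet> x)"] h_value by (simp add: max_value_def)
    have "h \<le> w \<bullet> z" if "\<forall>x\<in>ineq_polyhedron m A b. w \<bullet> x \<le> w \<bullet> z"
    proof -
      have "max_value (\<lambda>x. w \<bullet> x) (ineq_polyhedron m A b) \<le> ereal (w \<bullet> z)"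
        using that by (auto simp: max_value_def intro: SUP_least)
      then show ?thesis
        by (simp add: h_value)
    qed
    then show ?thesis
      using le by (force simp: max_optimal_iff intro: antisym)
  qed
  have "w \<bullet> (inverse t *\<^sub>R y) = h \<longleftrightarrow> w \<bullet> y = t * h"
    using False by (simp add: field_simps)
  then show ?thesis
    using False t by (simp add: opt slice_pos_iff)
qed

text \<open>
  An optimal point of \<open>Q\<close> dominates \<open>\<Sum>i. l'\<^sub>i h\<^sub>i\<close> for every
  \<open>l' \<in> S\<close>, as near-optimal points of the blocks, scaled by \<open>l'\<close>, show. The choice
  \<open>l' = l\<close> makes the bounds of the blocks tight, because their sum is; the other choices then
  say that \<open>l\<close> is optimal.
\<close>
lemma max_optimal_extended_polyhedron:
  fixes A :: "'i::finite \<Rightarrow> nat \<Rightarrow> real ^ 'n::finite" and C :: "nat \<Rightarrow> real ^ 'i"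
    and h :: "'i \<Rightarrow> real"
    and m :: "'i \<Rightarrow> nat" and b :: "'i \<Rightarrow> nat \<Rightarrow> real" and r :: nat and d :: "nat \<Rightarrow> real"
  defines "P \<equiv> \<lambda>i. ineq_polyhedron (m i) (A i) (b i)"
    and "S \<equiv> ineq_polyhedron r C d"
    and "Q \<equiv> extended_polyhedron m A b r C d"
  assumes h: "\<And>i x. x \<in> P i \<Longrightarrow> w \<bullet> x \<le> h i"
    and h_approx: "\<And>i e. 0 < e \<Longrightarrow> \<exists>x\<in>P i. h i - e < w \<bullet> x"
    and S_01: "zero_one_polytope S"
  shows "max_optimal (\<lambda>(x, y, l). w \<bullet> x) Q (x, y, l) \<longleftrightarrow>
      x = (\<Sum>i\<in>UNIV. y $ i) \<and>
      (\<forall>i. y $ i \<in> slice (m i) (A i) (b i) (l $ i) \<and> w \<bullet> y $ i = l $ i * h i) \<and>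
      max_optimal (\<lambda>l. \<Sum>i\<in>UNIV. h i * l $ i) S l" (is "?L \<longleftrightarrow> ?R")
proof
  note mem_Q = mem_extended_polyhedron[of _ _ _ m A b r C d, folded Q_def S_def]
  note l_nonneg = zero_one_polytope_bounds(1)[OF S_01]
  have nonempty: "P i \<noteq> {}" for i
    using h_approx[of 1 i] by auto
  have le: "w \<bullet> y $ i \<le> l $ i * h i" if "(x, y, l) \<in> Q" for x y l i
    using that nonempty[of i] h[of _ i] l_nonneg[of l i] unfolding P_def
    by (intro inner_slice_le) (auto simp: mem_Q)
  {
    assume ?L
    then have Q: "(x, y, l) \<in> Q" and opt: "\<And>x' y' l'. (x', y', l') \<in> Q \<Longrightarrow> w \<bullet> x' \<le> w \<bullet> x"
      by (force simp: max_optimal_iff)+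
    from Q have x: "x = (\<Sum>i\<in>UNIV. y $ i)" and l: "l \<in> S"
      and y: "\<And>i. y $ i \<in> slice (m i) (A i) (b i) (l $ i)"
      by (simp_all add: mem_Q)
    have attained: "(\<Sum>i\<in>UNIV. l' $ i * h i) \<le> w \<bullet> x" if l': "l' \<in> S" for l'
    proof (rule field_le_epsilon)
      fix e :: real assume "0 < e"
      \<comment> \<open>An error below \<open>e'\<close> per block adds up to at most \<open>e\<close>, as
        \<open>l'\<^sub>i \<le> 1\<close>.\<close>
      define e' where "e' = e / CARD('i)"
      have "0 < e'"
        using \<open>0 < e\<close> by (simp add: e'_def)
      then obtain p where p: "\<And>i. p i \<in> P i" "\<And>i. h i - e' < w \<bullet> p i"
        using h_approx by metis
      define y' where "y' = (\<chi> i. l' $ i *\<^sub>R p i)"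
      have "y' $ i \<in> slice (m i) (A i) (b i) (l' $ i)" for i
        using slice_scaleR[of "l' $ i" "p i" "m i" "A i" "b i" 1] p(1)[of i] l_nonneg[OF l']
        by (simp add: y'_def slice_1 P_def)
      then have "(\<Sum>i\<in>UNIV. y' $ i, y', l') \<in> Q"
        using l' by (simp add: mem_Q)
      then have "(\<Sum>i\<in>UNIV. w \<bullet> y' $ i) \<le> w \<bullet> x"
        using opt by (metis inner_sum_right)
      moreover have "(\<Sum>i\<in>UNIV. l' $ i * h i) \<le> (\<Sum>i\<in>UNIV. w \<bullet> y' $ i + e')"
      proof (rule sum_mono)
        fix i
        have "l' $ i * h i \<le> l' $ i * (w \<bullet> p i + e')"
          using p(2)[of i] l_nonneg[OF l'] by (intro mult_left_mono) auto
        also have "\<dots> \<le> w \<bullet> y' $ i + e'"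
          using zero_one_polytope_bounds[OF S_01 l', of i] \<open>0 < e'\<close>
            mult_right_mono[of "l' $ i" 1 e']
          by (simp add: y'_def algebra_simps)
        finally show "l' $ i * h i \<le> w \<bullet> y' $ i + e'" .
      qed
      ultimately show "(\<Sum>i\<in>UNIV. l' $ i * h i) \<le> w \<bullet> x + e"
        by (simp add: sum.distrib e'_def)
    qed
    have h_value: "w \<bullet> x = (\<Sum>i\<in>UNIV. w \<bullet> y $ i)"
      by (simp add: x inner_sum_right)
    have "(\<Sum>i\<in>UNIV. w \<bullet> y $ i) = (\<Sum>i\<in>UNIV. l $ i * h i)"
      using attained[OF l] le[OF Q] by (auto simp: h_value intro!: antisym sum_mono)
    from sum_mono_inv[OF this le[OF Q]] have tight: "w \<bullet> y $ i = l $ i * h i" for i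
      by simp
    have "max_optimal (\<lambda>l. \<Sum>i\<in>UNIV. h i * l $ i) S l"
      using l attained by (simp add: max_optimal_iff h_value tight mult.commute)
    then show ?R
      using x y tight by simp
  next
    assume R: ?R
    then have x: "x = (\<Sum>i\<in>UNIV. y $ i)" and tight: "\<And>i. w \<bullet> y $ i = l $ i * h i"
      and y: "\<And>i. y $ i \<in> slice (m i) (A i) (b i) (l $ i)"
      and l: "l \<in> S" "\<And>l'. l' \<in> S \<Longrightarrow> (\<Sum>i\<in>UNIV. h i * l' $ i) \<le> (\<Sum>i\<in>UNIV. h i * l $ i)"
      by (auto simp: max_optimal_iff)
    have "(x, y, l) \<in> Q"
      using x y l(1) by (simp add: mem_Q)
    moreover have "w \<bullet> x' \<le> w \<bullet> x" if "(x', y', l') \<in> Q" for x' y' l'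
    proof -
      have "w \<bullet> x' = (\<Sum>i\<in>UNIV. w \<bullet> y' $ i)"
        using that by (simp add: mem_Q inner_sum_right)
      also have "\<dots> \<le> (\<Sum>i\<in>UNIV. h i * l' $ i)"
        using le[OF that] by (intro sum_mono) (simp add: mult.commute)
      also have "\<dots> \<le> (\<Sum>i\<in>UNIV. h i * l $ i)"
        using that by (intro l(2)) (simp add: mem_Q)
      also have "\<dots> = w \<bullet> x"
        by (simp add: x inner_sum_right tight mult.commute)
      finally show ?thesis .
    qed
    ultimately show ?L
      by (auto simp: max_optimal_iff)
  }
qed

section \<open>Vertices and optimal solutions of the extended formulation\<close>

theorem theorem1p2:
  fixes m :: "'i::finite \<Rightarrow> nat" and A :: "'i \<Rightarrow> nat \<Rightarrow> real ^ 'n::finite" and b :: "'i \<Rightarrow> nat \<Rightarrow> real"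
    and r :: nat and C :: "nat \<Rightarrow> real ^ 'i" and d :: "nat \<Rightarrow> real"
    and P :: "'i \<Rightarrow> (real ^ 'n) set" and S :: "(real ^ 'i) set"
    and Q :: "((real ^ 'n) \<times> (real ^ 'n ^ 'i) \<times> (real ^ 'i)) set"
  assumes P: "\<And>i. P i = ineq_polyhedron (m i) (A i) (b i)"
    and P_nonempty: "\<And>i. P i \<noteq> {}"
    and P_pointed: "\<And>i. pointed (P i)"
    and S: "S = ineq_polyhedron r C d"
    and S_01: "zero_one_polytope S"
    and Q: "Q = extended_polyhedron m A b r C d"
  shows
    "(\<forall>x y l. (x, y, l) extreme_point_of Q \<longleftrightarrow>
        x = (\<Sum>i\<in>UNIV. y $ i) \<and> l extreme_point_of S \<and>
        (\<forall>i. if l $ i = 1 then (y $ i) extreme_point_of (P i) else y $ i = 0)) \<and>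
     (\<forall>w :: real ^ 'n.
        (S \<noteq> {} \<longrightarrow>
          (max_unbounded (\<lambda>(x, y, l). w \<bullet> x) Q \<longleftrightarrow>
            (\<exists>i. max_value (\<lambda>x. w \<bullet> x) (P i) = \<infinity>))) \<and>
        (\<not> max_unbounded (\<lambda>(x, y, l). w \<bullet> x) Q \<longrightarrow>
          (\<forall>x y l. max_optimal (\<lambda>(x, y, l). w \<bullet> x) Q (x, y, l) \<longleftrightarrow>
            x = (\<Sum>i\<in>UNIV. y $ i) \<and>
            (\<forall>i. l $ i > 0 \<longrightarrow> max_optimal (\<lambda>x. w \<bullet> x) (P i) (inverse (l $ i) *\<^sub>R (y $ i))) \<and>
            (\<forall>i. l $ i = 0 \<longrightarrow> (\<forall>k<m i. A i k \<bullet> (y $ i) \<ge> 0) \<and> w \<bullet> (y $ i) = 0) \<and>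
            max_optimal (\<lambda>l. \<Sum>i\<in>UNIV. max_value (\<lambda>x. w \<bullet> x) (P i) * ereal (l $ i)) S l)))"
proof (intro conjI allI impI)
  have hyps: "\<And>i. ineq_polyhedron (m i) (A i) (b i) \<noteq> {}"
    "\<And>i. pointed (ineq_polyhedron (m i) (A i) (b i))" "zero_one_polytope (ineq_polyhedron r C d)"
    using P_nonempty P_pointed S_01 by (simp_all add: P S)
  fix x :: "real ^ 'n" and y :: "real ^ 'n ^ 'i" and l :: "real ^ 'i"
  show "(x, y, l) extreme_point_of Q \<longleftrightarrow>
      x = (\<Sum>i\<in>UNIV. y $ i) \<and> l extreme_point_of S \<and>
      (\<forall>i. if l $ i = 1 then (y $ i) extreme_point_of (P i) else y $ i = 0)"
    unfolding P S Q by (rule extreme_point_of_extended_polyhedron[OF hyps])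
  fix w :: "real ^ 'n"
  have unbounded_iff: "max_unbounded (\<lambda>(x, y, l). w \<bullet> x) Q \<longleftrightarrow>
      (\<exists>i. max_value (\<lambda>x. w \<bullet> x) (P i) = \<infinity>)" if "S \<noteq> {}"
    using that hyps unfolding P S Q by (intro extended_objective_unbounded_iff)
  then show "max_unbounded (\<lambda>(x, y, l). w \<bullet> x) Q \<longleftrightarrow>
      (\<exists>i. max_value (\<lambda>x. w \<bullet> x) (P i) = \<infinity>)" if "S \<noteq> {}"
    using that by blast
  assume bounded: "\<not> max_unbounded (\<lambda>(x, y, l). w \<bullet> x) Q"
  show "max_optimal (\<lambda>(x, y, l). w \<bullet> x) Q (x, y, l) \<longleftrightarrow>
      x = (\<Sum>i\<in>UNIV. y $ i) \<and>
      (\<forall>i. l $ i > 0 \<longrightarrow> max_optimal (\<lambda>x. w \<bullet> x) (P i) (inverse (l $ i) *\<^sub>R (y $ i))) \<and>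
      (\<forall>i. l $ i = 0 \<longrightarrow> (\<forall>k<m i. A i k \<bullet> (y $ i) \<ge> 0) \<and> w \<bullet> (y $ i) = 0) \<and>
      max_optimal (\<lambda>l. \<Sum>i\<in>UNIV. max_value (\<lambda>x. w \<bullet> x) (P i) * ereal (l $ i)) S l"
    (is "?L \<longleftrightarrow> ?R")
  proof (cases "l \<in> S")
    \<comment> \<open>This case also covers an empty \<open>S\<close>, over which suprema \<open>\<infinity>\<close> may occur although
      (A) is bounded.\<close>
    case False
    then have "(x, y, l) \<notin> Q"
      unfolding Q S mem_extended_polyhedron by blast
    then show ?thesis
      using False unfolding max_optimal_iff by blast
  next
    case True
    then have "max_value (\<lambda>x. w \<bullet> x) (P i) \<noteq> \<infinity>" for i
      using bounded unbounded_iff by blast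
    then have "\<forall>i. \<exists>h. max_value (\<lambda>x. w \<bullet> x) (P i) = ereal h \<and> (\<forall>x\<in>P i. w \<bullet> x \<le> h) \<and>
        (\<forall>e>0. \<exists>x\<in>P i. h - e < w \<bullet> x)"
      using max_value_finite[OF P_nonempty] by metis
    then obtain h where h_value: "\<And>i. max_value (\<lambda>x. w \<bullet> x) (P i) = ereal (h i)"
      and h: "\<And>i x. x \<in> P i \<Longrightarrow> w \<bullet> x \<le> h i" "\<And>i e. 0 < e \<Longrightarrow> \<exists>x\<in>P i. h i - e < w \<bullet> x"
      by metis
    note block = inner_slice_eq_iff[OF h_value[unfolded P] zero_one_polytope_bounds(1)[OF S_01 True]]
    have "?L \<longleftrightarrow> x = (\<Sum>i\<in>UNIV. y $ i) \<and>
        (\<forall>i. y $ i \<in> slice (m i) (A i) (b i) (l $ i) \<and> w \<bullet> y $ i = l $ i * h i) \<and>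
        max_optimal (\<lambda>l. \<Sum>i\<in>UNIV. h i * l $ i) S l"
      using h hyps(3) unfolding P S Q by (intro max_optimal_extended_polyhedron)
    then show ?thesis
      unfolding block P[symmetric] by (auto simp: h_value max_optimal_iff)
  qed
qed

end
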